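(* The category $Q\text{-}\mathbf{SOB}$ of $Q$-sober topological spaces is the epireflective hull of the $Q$-Sierpinski space $Q_S$ in the category $Q\text{-}\mathbf{TOP}_0$ of $Q$-$T_0$-topological spaces.
   Context: Fix a class $\Omega=(n_\lambda)_{\lambda\in I}$ of cardinal numbers. An $\Omega$-algebra is a set $A$ with a family of maps $\omega_\lambda^A:A^{n_\lambda}\to A$ ($\lambda\in I$); a subalgebra is a subset closed under all these operations; $\langle S\rangle$ denotes the subalgebra generated by a subset $S$ (the intersection of all subalgebras containing $S$); $\Omega$-algebra homomorphisms are maps commuting with all operations. A variety is a full subcategory of the category of $\Omega$-algebras closed under products, subalgebras and homomorphic images. Fix a variety $\mathbf{A}$ and a member $Q$ of $\mathbf{A}$. For a set $X$, $Q^X$ is an $\Omega$-algebra with pointwise operations. A $Q$-topology on a set $X$ is a subalgebra $\tau$ of $Q^X$; then $(X,\tau)$ is a $Q$-topological space. A function $f:(X,\tau)\to(Y,\delta)$ is $Q$-continuous if $q\circ f\in\tau$ for all $q\in\delta$. $Q\text{-}\mathbf{TOP}$ is the category of $Q$-topological spaces and $Q$-continuous maps. $(X,\tau)$ is $Q$-$T_0$ if for all distinct $x,y\in X$ there is $p\in\tau$ with $p(x)\ne p(y)$. $Q\text{-}\mathbf{TOP}_0$ is the full subcategory of $Q$-$T_0$ spaces. The $Q$-Sierpinski space is $Q_S=(Q,\nu)$, where $\nu=\langle \mathrm{id}_Q\rangle$ is the subalgebra of $Q^Q$ generated by the identity map $\mathrm{id}_Q$. For a $Q$-topological space $(X,\tau)$,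 let $pt\tau=\hom_{\mathbf{A}}(\tau,Q)$ be the set of $\Omega$-algebra homomorphisms $\tau\to Q$, and let $\eta_X:X\to pt\tau$ be $\eta_X(x)(p)=p(x)$. The space $(X,\tau)$ is $Q$-sober if $\eta_X$ is bijective. $Q\text{-}\mathbf{SOB}$ is the full subcategory of $Q$-sober spaces (every $Q$-sober space is $Q$-$T_0$). All subcategories are full. A subcategory $\mathscr{R}$ of a category $\mathscr{C}$ is epireflective in $\mathscr{C}$ if for each $\mathscr{C}$-object $X$ there is a $\mathscr{C}$-epimorphism $r_X:X\to RX$ with $RX\in\mathscr{R}$ such that every $\mathscr{C}$-morphism $f:X\to Y$ with $Y\in\mathscr{R}$ factors as $f=f^*\circ r_X$ for a unique $\mathscr{R}$-morphism $f^*:RX\to Y$. The epireflective hull of an object $C$ in $\mathscr{C}$ is the smallest (full, isomorphism-closed) epireflective subcategory of $\mathscr{C}$ containing $C$. *)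

theory Defs
  imports "HOL-Library.FuncSet" "HOL-Library.Equipollence"
begin

section \<open>Size\<close>

text \<open>
  The sets of the theory are the subsets of a type \<open>'u\<close> that have smaller cardinality than
  \<open>'u\<close> itself. If \<open>'u\<close> has strongly inaccessible cardinality, these are, up to bijection, the
  sets of a Grothendieck universe, and the objects of the categories below form a proper class
  relative to it. All that is required of \<open>'u\<close> is that its cardinality is a strong limit, i.e. that
  the small sets are closed under power sets.
\<close>

definition small :: "'u set \<Rightarrow> bool" where
  "small X \<longleftrightarrow> X \<prec> (UNIV :: 'u set)"

definition strong_limit :: "'u itself \<Rightarrow> bool" where
  "strong_limit _ \<longleftrightarrow> (\<forall>X :: 'u set. small X \<longrightarrow> Pow X \<prec> (UNIV :: 'u set))"


section \<open>Universal algebra\<close>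

text \<open>
  The cardinal number \<open>n\<^sub>\<lambda>\<close> is represented by a set \<open>arity \<Omega> \<lambda>\<close> of argument positions, and
  \<open>A\<^bsup>n\<^esup>\<close> by the extensional functions from that set to \<open>A\<close>. The index class
  \<open>index \<Omega>\<close> and the arities are not required to be small or bounded.
\<close>

record ('i, 'n) signature =
  index :: "'i set"
  arity :: "'i \<Rightarrow> 'n set"

record ('i, 'n, 'a) algebra =
  carrier :: "'a set"
  oper :: "'i \<Rightarrow> ('n \<Rightarrow> 'a) \<Rightarrow> 'a"

definition is_algebra :: "('i, 'n) signature \<Rightarrow> ('i, 'n, 'a) algebra \<Rightarrow> bool" where
  "is_algebra \<Omega> A \<longleftrightarrow>
     (\<forall>l \<in> index \<Omega>. \<forall>a \<in> arity \<Omega> l \<rightarrow>\<^sub>E carrier A. oper A l a \<in> carrier A)"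

definition subalgebra :: "('i, 'n) signature \<Rightarrow> ('i, 'n, 'a) algebra \<Rightarrow> 'a set \<Rightarrow> bool" where
  "subalgebra \<Omega> A S \<longleftrightarrow>
     S \<subseteq> carrier A \<and> (\<forall>l \<in> index \<Omega>. \<forall>a \<in> arity \<Omega> l \<rightarrow>\<^sub>E S. oper A l a \<in> S)"

definition restrict_algebra :: "('i, 'n, 'a) algebra \<Rightarrow> 'a set \<Rightarrow> ('i, 'n, 'a) algebra" where
  "restrict_algebra A S = \<lparr>carrier = S, oper = oper A\<rparr>"

definition generated :: "('i, 'n) signature \<Rightarrow> ('i, 'n, 'a) algebra \<Rightarrow> 'a set \<Rightarrow> 'a set" where
  "generated \<Omega> A S = \<Inter> {B. subalgebra \<Omega> A B \<and> S \<subseteq> B}"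

definition alg_hom ::
  "('i, 'n) signature \<Rightarrow> ('i, 'n, 'a) algebra \<Rightarrow> ('i, 'n, 'b) algebra \<Rightarrow> ('a \<Rightarrow> 'b) set" where
  "alg_hom \<Omega> A B =
     {h \<in> carrier A \<rightarrow>\<^sub>E carrier B.
        \<forall>l \<in> index \<Omega>. \<forall>a \<in> arity \<Omega> l \<rightarrow>\<^sub>E carrier A.
          h (oper A l a) = oper B l (\<lambda>k \<in> arity \<Omega> l. h (a k))}"

definition prod_algebra ::
  "('i, 'n) signature \<Rightarrow> 'x set \<Rightarrow> ('x \<Rightarrow> ('i, 'n, 'a) algebra) \<Rightarrow> ('i, 'n, 'x \<Rightarrow> 'a) algebra" where
  "prod_algebra \<Omega> X F =
     \<lparr>carrier = (\<Pi>\<^sub>E x \<in> X. carrier (F x)),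
      oper = (\<lambda>l a. \<lambda>x \<in> X. oper (F x) l (\<lambda>k \<in> arity \<Omega> l. a k x))\<rparr>"

abbreviation power_algebra ::
  "('i, 'n) signature \<Rightarrow> ('i, 'n, 'a) algebra \<Rightarrow> 'x set \<Rightarrow> ('i, 'n, 'x \<Rightarrow> 'a) algebra" where
  "power_algebra \<Omega> Q X \<equiv> prod_algebra \<Omega> X (\<lambda>_. Q)"

text \<open>
  Being a full subcategory, a variety is given by its class of objects. The elements of a product
  algebra are functions and so do not live in \<open>'u\<close>; closure under products therefore says that
  every isomorphic copy of the product on a small subset of \<open>'u\<close> belongs to the variety.
\<close>

definition variety :: "('i, 'n) signature \<Rightarrow> ('i, 'n, 'u) algebra set \<Rightarrow> bool" where
  "variety \<Omega> V \<longleftrightarrow>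
     (\<forall>A \<in> V. is_algebra \<Omega> A \<and> small (carrier A)) \<and>
     (\<forall>(J :: 'u set) F B h.
        small J \<longrightarrow> (\<forall>j \<in> J. F j \<in> V) \<longrightarrow> is_algebra \<Omega> B \<longrightarrow> small (carrier B) \<longrightarrow>
        h \<in> alg_hom \<Omega> (prod_algebra \<Omega> J F) B \<longrightarrow>
        bij_betw h (carrier (prod_algebra \<Omega> J F)) (carrier B) \<longrightarrow> B \<in> V) \<and>
     (\<forall>A \<in> V. \<forall>S. subalgebra \<Omega> A S \<longrightarrow> restrict_algebra A S \<in> V) \<and>
     (\<forall>A \<in> V. \<forall>B h.
        is_algebra \<Omega> B \<longrightarrow> h \<in> alg_hom \<Omega> A B \<longrightarrow> h ` carrier A = carrier B \<longrightarrow> B \<in> V)"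


section \<open>Categories and epireflective hulls\<close>

text \<open>\<open>comp C X Y Z g f\<close> is the composite of \<open>f : X \<rightarrow> Y\<close> and \<open>g : Y \<rightarrow> Z\<close>.\<close>

record ('o, 'm) category =
  Obj :: "'o set"
  Hom :: "'o \<Rightarrow> 'o \<Rightarrow> 'm set"
  comp :: "'o \<Rightarrow> 'o \<Rightarrow> 'o \<Rightarrow> 'm \<Rightarrow> 'm \<Rightarrow> 'm"
  ident :: "'o \<Rightarrow> 'm"

definition is_category :: "('o, 'm) category \<Rightarrow> bool" where
  "is_category C \<longleftrightarrow>
     (\<forall>X \<in> Obj C. ident C X \<in> Hom C X X) \<and>
     (\<forall>X \<in> Obj C. \<forall>Y \<in> Obj C. \<forall>f \<in> Hom C X Y.
        comp C X X Y f (ident C X) = f \<and> comp C X Y Y (ident C Y) f = f) \<and>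
     (\<forall>X \<in> Obj C. \<forall>Y \<in> Obj C. \<forall>Z \<in> Obj C. \<forall>f \<in> Hom C X Y. \<forall>g \<in> Hom C Y Z.
        comp C X Y Z g f \<in> Hom C X Z) \<and>
     (\<forall>W \<in> Obj C. \<forall>X \<in> Obj C. \<forall>Y \<in> Obj C. \<forall>Z \<in> Obj C.
        \<forall>f \<in> Hom C W X. \<forall>g \<in> Hom C X Y. \<forall>h \<in> Hom C Y Z.
          comp C W Y Z h (comp C W X Y g f) = comp C W X Z (comp C X Y Z h g) f)"

definition full_subcategory :: "('o, 'm) category \<Rightarrow> 'o set \<Rightarrow> ('o, 'm) category" where
  "full_subcategory C S = C\<lparr>Obj := S\<rparr>"

definition epimorphism :: "('o, 'm) category \<Rightarrow> 'o \<Rightarrow> 'o \<Rightarrow> 'm \<Rightarrow> bool" where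
  "epimorphism C X Y e \<longleftrightarrow>
     e \<in> Hom C X Y \<and>
     (\<forall>Z \<in> Obj C. \<forall>f \<in> Hom C Y Z. \<forall>g \<in> Hom C Y Z.
        comp C X Y Z f e = comp C X Y Z g e \<longrightarrow> f = g)"

definition isomorphic :: "('o, 'm) category \<Rightarrow> 'o \<Rightarrow> 'o \<Rightarrow> bool" where
  "isomorphic C X Y \<longleftrightarrow>
     (\<exists>f \<in> Hom C X Y. \<exists>g \<in> Hom C Y X.
        comp C X Y X g f = ident C X \<and> comp C Y X Y f g = ident C Y)"

definition iso_closed :: "('o, 'm) category \<Rightarrow> 'o set \<Rightarrow> bool" where
  "iso_closed C R \<longleftrightarrow> (\<forall>X \<in> R. \<forall>Y \<in> Obj C. isomorphic C X Y \<longrightarrow> Y \<in> R)"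

text \<open>All subcategories are full, so a subcategory is given by its class \<open>R\<close> of objects.\<close>

definition epireflective :: "('o, 'm) category \<Rightarrow> 'o set \<Rightarrow> bool" where
  "epireflective C R \<longleftrightarrow>
     R \<subseteq> Obj C \<and>
     (\<forall>X \<in> Obj C. \<exists>RX \<in> R. \<exists>r. epimorphism C X RX r \<and>
        (\<forall>Y \<in> R. \<forall>f \<in> Hom C X Y. \<exists>!f'. f' \<in> Hom C RX Y \<and> f = comp C X RX Y f' r))"

definition is_epireflective_hull :: "('o, 'm) category \<Rightarrow> 'o \<Rightarrow> 'o set \<Rightarrow> bool" where
  "is_epireflective_hull C c R \<longleftrightarrow>
     epireflective C R \<and> iso_closed C R \<and> c \<in> R \<and>
     (\<forall>R'. epireflective C R' \<longrightarrow> iso_closed C R' \<longrightarrow> c \<in> R' \<longrightarrow> R \<subseteq> R')"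


section \<open>\<open>Q\<close>-topological spaces\<close>

type_synonym ('u, 'q) qspace = "'u set \<times> ('u \<Rightarrow> 'q) set"

definition Q_topology ::
  "('i, 'n) signature \<Rightarrow> ('i, 'n, 'q) algebra \<Rightarrow> 'u set \<Rightarrow> ('u \<Rightarrow> 'q) set \<Rightarrow> bool" where
  "Q_topology \<Omega> Q X \<tau> \<longleftrightarrow> subalgebra \<Omega> (power_algebra \<Omega> Q X) \<tau>"

definition Q_continuous_maps :: "('u, 'q) qspace \<Rightarrow> ('u, 'q) qspace \<Rightarrow> ('u \<Rightarrow> 'u) set" where
  "Q_continuous_maps S T =
     {f \<in> fst S \<rightarrow>\<^sub>E fst T. \<forall>q \<in> snd T. compose (fst S) q f \<in> snd S}"

definition Q_TOP ::
  "('i, 'n) signature \<Rightarrow> ('i, 'n, 'q) algebra \<Rightarrow> (('u, 'q) qspace, 'u \<Rightarrow> 'u) category" where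
  "Q_TOP \<Omega> Q =
     \<lparr>Obj = {(X, \<tau>). small X \<and> Q_topology \<Omega> Q X \<tau>},
      Hom = Q_continuous_maps,
      comp = (\<lambda>S _ _ g f. compose (fst S) g f),
      ident = (\<lambda>S. \<lambda>x \<in> fst S. x)\<rparr>"

definition Q_T0 :: "('u, 'q) qspace \<Rightarrow> bool" where
  "Q_T0 S \<longleftrightarrow> (\<forall>x \<in> fst S. \<forall>y \<in> fst S. x \<noteq> y \<longrightarrow> (\<exists>p \<in> snd S. p x \<noteq> p y))"

definition Q_TOP0 ::
  "('i, 'n) signature \<Rightarrow> ('i, 'n, 'q) algebra \<Rightarrow> (('u, 'q) qspace, 'u \<Rightarrow> 'u) category" where
  "Q_TOP0 \<Omega> Q = full_subcategory (Q_TOP \<Omega> Q) {S \<in> Obj (Q_TOP \<Omega> Q). Q_T0 S}"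

definition Q_Sierpinski ::
  "('i, 'n) signature \<Rightarrow> ('i, 'n, 'u) algebra \<Rightarrow> ('u, 'u) qspace" where
  "Q_Sierpinski \<Omega> Q =
     (carrier Q, generated \<Omega> (power_algebra \<Omega> Q (carrier Q)) {\<lambda>x \<in> carrier Q. x})"

definition pt ::
  "('i, 'n) signature \<Rightarrow> ('i, 'n, 'q) algebra \<Rightarrow> ('u, 'q) qspace \<Rightarrow> (('u \<Rightarrow> 'q) \<Rightarrow> 'q) set" where
  "pt \<Omega> Q S = alg_hom \<Omega> (restrict_algebra (power_algebra \<Omega> Q (fst S)) (snd S)) Q"

definition eta :: "('u, 'q) qspace \<Rightarrow> 'u \<Rightarrow> ('u \<Rightarrow> 'q) \<Rightarrow> 'q" where
  "eta S x = (\<lambda>p \<in> snd S. p x)"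

definition Q_sober ::
  "('i, 'n) signature \<Rightarrow> ('i, 'n, 'q) algebra \<Rightarrow> ('u, 'q) qspace \<Rightarrow> bool" where
  "Q_sober \<Omega> Q S \<longleftrightarrow> bij_betw (eta S) (fst S) (pt \<Omega> Q S)"

definition Q_SOB ::
  "('i, 'n) signature \<Rightarrow> ('i, 'n, 'q) algebra \<Rightarrow> ('u, 'q) qspace set" where
  "Q_SOB \<Omega> Q = {S \<in> Obj (Q_TOP \<Omega> Q). Q_sober \<Omega> Q S}"

lemma is_category_Q_TOP: "is_category (Q_TOP \<Omega> Q)"
proof -
  have id: "compose X (\<lambda>x \<in> Y. x) f = f" if "f \<in> X \<rightarrow>\<^sub>E Y"
    for X :: "'x set" and Y :: "'y set" and f
    using Id_compose[of f X Y] that by (simp add: PiE_def)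
  have di: "compose X f (\<lambda>x \<in> X. x) = f" if "f \<in> X \<rightarrow>\<^sub>E Y"
    for X :: "'x set" and Y :: "'y set" and f
    using compose_Id[of f X Y] that by (simp add: PiE_def)
  have assoc: "compose X h (compose X g f) = compose X (compose Y h g) f" if "f \<in> X \<rightarrow>\<^sub>E Y"
    for X :: "'x set" and Y :: "'y set" and f and g :: "'y \<Rightarrow> 'z" and h :: "'z \<Rightarrow> 'w"
    using compose_assoc[of f X Y] that by (simp add: PiE_def)
  have comp_in: "compose X g f \<in> X \<rightarrow>\<^sub>E Z" if "f \<in> X \<rightarrow>\<^sub>E Y" "g \<in> Y \<rightarrow>\<^sub>E Z"
    for X :: "'x set" and Y :: "'y set" and Z :: "'z set" and f g
    using that by (auto simp: compose_def PiE_iff)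
  show ?thesis
    unfolding is_category_def
  proof (intro conjI ballI, goal_cases)
    case (1 S)
    have sub: "snd S \<subseteq> fst S \<rightarrow>\<^sub>E carrier Q"
      using 1 by (simp add: Q_TOP_def Q_topology_def subalgebra_def prod_algebra_def case_prod_beta)
    have "compose (fst S) q (\<lambda>x \<in> fst S. x) \<in> snd S" if "q \<in> snd S" for q
      using di[OF subsetD[OF sub that]] that by (simp only:)
    then show ?case
      by (simp add: Q_TOP_def Q_continuous_maps_def)
  next
    case (2 S T f)
    then have "f \<in> fst S \<rightarrow>\<^sub>E fst T"
      by (simp add: Q_TOP_def Q_continuous_maps_def)
    from di[OF this] show ?case by (simp add: Q_TOP_def)
  next
    case (3 S T f)
    then have "f \<in> fst S \<rightarrow>\<^sub>E fst T"
      by (simp add: Q_TOP_def Q_continuous_maps_def)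
    from id[OF this] show ?case by (simp add: Q_TOP_def)
  next
    case (4 S T U f g)
    then have f: "f \<in> fst S \<rightarrow>\<^sub>E fst T" and g: "g \<in> fst T \<rightarrow>\<^sub>E fst U"
      and *: "\<And>q. q \<in> snd T \<Longrightarrow> compose (fst S) q f \<in> snd S"
        "\<And>q. q \<in> snd U \<Longrightarrow> compose (fst T) q g \<in> snd T"
      by (simp_all add: Q_TOP_def Q_continuous_maps_def)
    have "compose (fst S) q (compose (fst S) g f) \<in> snd S" if "q \<in> snd U" for q
      unfolding assoc[OF f] by (intro * that)
    with comp_in[OF f g] show ?case
      by (simp add: Q_TOP_def Q_continuous_maps_def)
  next
    case (5 R S T U f g h)
    then have "f \<in> fst R \<rightarrow>\<^sub>E fst S"
      by (simp add: Q_TOP_def Q_continuous_maps_def)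
    from assoc[OF this] show ?case by (simp add: Q_TOP_def)
  qed
qed

end

theory Submission
  imports Defs
begin

text \<open>
  The reflection of a \<open>T\<^sub>0\<close> space \<open>X\<close> is its space of points \<open>pt \<tau>\<close>, whose topology consists of
  the evaluations at the members of \<open>\<tau>\<close>. An evaluation is determined by its restriction along
  \<open>\<eta>\<close>, so \<open>\<eta>\<close> is an epimorphism in \<open>T\<^sub>0\<close> spaces. For minimality, the continuous maps from \<open>X\<close>
  to the Sierpinski space are exactly the members of \<open>\<tau>\<close>. Hence a reflection \<open>r : X \<rightarrow> R\<close> into any
  class containing the Sierpinski space induces an isomorphism of the algebra of \<open>R\<close> with \<open>\<tau>\<close>;
  every point of \<open>R\<close> thus yields a point of \<open>\<tau>\<close>, and if \<open>X\<close> is sober this defines an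
  inverse of \<open>r\<close>.
\<close>

section \<open>Small sets\<close>

text \<open>If \<open>'u\<close> had n + 1 elements, removing one would leave a small set whose
  power set has 2^n \<ge> n + 1 elements and so is not small.\<close>

lemma infinite_UNIV_of_strong_limit:
  assumes "strong_limit TYPE('u)"
  shows "infinite (UNIV :: 'u set)"
proof
  assume fin: "finite (UNIV :: 'u set)"
  obtain a :: 'u where True by blast
  let ?X = "UNIV - {a}"
  have card: "card (UNIV :: 'u set) = Suc (card ?X)"
    by (rule card.remove[OF fin UNIV_I])
  have "\<not> ?X \<approx> (UNIV :: 'u set)"
    using fin card eqpoll_iff_card[of ?X "UNIV :: 'u set"] by simp
  then have "?X \<prec> (UNIV :: 'u set)"
    by (simp add: lesspoll_def subset_imp_lepoll)
  then have "Pow ?X \<prec> (UNIV :: 'u set)"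
    using assms by (simp add: strong_limit_def small_def)
  moreover have "card (UNIV :: 'u set) \<le> card (Pow ?X)"
    using fin less_exp[of "card ?X"] by (simp only: card card_Pow finite_Diff Suc_le_eq)
  then have "(UNIV :: 'u set) \<lesssim> Pow ?X"
    using fin by (simp add: lepoll_iff_card_le)
  ultimately show False
    using lesspoll_trans1 lesspoll_not_refl by blast
qed

text \<open>The strong limit property speaks of subsets of \<open>'u\<close> only; an injection into
  \<open>'u\<close> transports it to sets of any type, such as sets of functions.\<close>

lemma Pow_lesspoll_UNIV:
  assumes "strong_limit TYPE('u)" "A \<prec> (UNIV :: 'u set)"
  shows "Pow A \<prec> (UNIV :: 'u set)"
proof -
  obtain f :: "'a \<Rightarrow> 'u" where f: "inj_on f A"
    using assms(2) by (auto simp: lesspoll_def lepoll_def)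
  then have "f ` A \<prec> (UNIV :: 'u set)"
    using assms(2) by simp
  then have "Pow (f ` A) \<prec> (UNIV :: 'u set)"
    using assms(1) by (simp add: strong_limit_def small_def)
  moreover have "Pow A \<lesssim> Pow (f ` A)"
    using f unfolding lepoll_def
    by (intro exI[of _ "image f"]) (auto simp: inj_on_image_Pow)
  ultimately show ?thesis
    by (rule lesspoll_trans1[rotated])
qed

text \<open>The product embeds into the square of the larger factor. An infinite square is
  equipollent to its base, and a finite one is smaller than any infinite set.\<close>

lemma Times_lesspoll_UNIV:
  assumes inf: "infinite (UNIV :: 'u set)"
    and A: "A \<prec> (UNIV :: 'u set)" and B: "B \<prec> (UNIV :: 'u set)"
  shows "A \<times> B \<prec> (UNIV :: 'u set)"
proof -
  have square: "C \<times> C \<prec> (UNIV :: 'u set)" if "C \<prec> (UNIV :: 'u set)" for C :: "'c set"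
  proof (cases "finite C")
    case True
    then show ?thesis
      using inf by (simp add: finite_lesspoll_infinite)
  next
    case False
    then have "C \<times> C \<approx> C"
      by (simp add: card_of_Times_same_infinite eqpoll_iff_card_of_ordIso)
    then show ?thesis
      using that by (rule eq_lesspoll_trans)
  qed
  consider "A \<lesssim> B" | "B \<lesssim> A"
    unfolding lepoll_def by (metis card_of_ordLeq ordLeq_total card_of_Well_order)
  then show ?thesis
  proof cases
    case 1
    then have "A \<times> B \<lesssim> B \<times> B"
      by (rule times_lepoll_mono) simp
    then show ?thesis
      using square[OF B] by (rule lesspoll_trans1)
  next
    case 2
    then have "A \<times> B \<lesssim> A \<times> A"
      by (intro times_lepoll_mono) simp_all
    then show ?thesis
      using square[OF A] by (rule lesspoll_trans1)
  qed
qed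

text \<open>An extensional function is determined by its graph, so the function set embeds into
  \<open>Pow (A \<times> B)\<close>.\<close>

lemma PiE_lesspoll_UNIV:
  assumes "strong_limit TYPE('u)" "A \<prec> (UNIV :: 'u set)" "B \<prec> (UNIV :: 'u set)"
  shows "A \<rightarrow>\<^sub>E B \<prec> (UNIV :: 'u set)"
proof -
  have "inj_on (\<lambda>f. (\<lambda>x. (x, f x)) ` A) (A \<rightarrow>\<^sub>E B)"
  proof (rule inj_onI)
    fix f g assume fg: "f \<in> A \<rightarrow>\<^sub>E B" "g \<in> A \<rightarrow>\<^sub>E B"
      and eq: "(\<lambda>x. (x, f x)) ` A = (\<lambda>x. (x, g x)) ` A"
    from eq have "f x = g x" if "x \<in> A" for x
      using that by blast
    with fg show "f = g" by (rule PiE_ext)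
  qed
  then have "A \<rightarrow>\<^sub>E B \<lesssim> Pow (A \<times> B)"
    unfolding lepoll_def by (intro exI conjI) auto
  then show ?thesis
    using Pow_lesspoll_UNIV[OF assms(1) Times_lesspoll_UNIV]
      infinite_UNIV_of_strong_limit assms by (blast intro: lesspoll_trans1)
qed


section \<open>Powers and points\<close>

lemma carrier_power_algebra [simp]:
  "carrier (power_algebra \<Omega> Q X) = X \<rightarrow>\<^sub>E carrier Q"
  by (simp add: prod_algebra_def)

lemma oper_power_algebra:
  "oper (power_algebra \<Omega> Q X) l a = (\<lambda>x\<in>X. oper Q l (\<lambda>k\<in>arity \<Omega> l. a k x))"
  by (simp add: prod_algebra_def)

lemma oper_power_algebra_apply:
  "x \<in> X \<Longrightarrow> oper (power_algebra \<Omega> Q X) l a x = oper Q l (\<lambda>k\<in>arity \<Omega> l. a k x)"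
  by (simp add: oper_power_algebra)

text \<open>Operations of a power are computed pointwise, so precomposition with \<open>r\<close> is
  compatible with them; outside \<open>X\<close> both sides are \<open>undefined\<close>. This lets
  continuous maps act on topologies as homomorphisms.\<close>

lemma compose_oper_power_algebra:
  assumes "r \<in> X \<rightarrow>\<^sub>E Y"
  shows "compose X (oper (power_algebra \<Omega> Q Y) l b) r =
    oper (power_algebra \<Omega> Q X) l (\<lambda>k\<in>arity \<Omega> l. compose X (b k) r)"
proof
  fix x
  show "compose X (oper (power_algebra \<Omega> Q Y) l b) r x =
      oper (power_algebra \<Omega> Q X) l (\<lambda>k\<in>arity \<Omega> l. compose X (b k) r) x"
  proof (cases "x \<in> X")
    case True
    then show ?thesis
      using PiE_mem[OF assms True]
      by (simp add: oper_power_algebra_apply compose_eq cong: restrict_cong)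
  next
    case False
    then show ?thesis
      by (simp add: oper_power_algebra compose_def)
  qed
qed

text \<open>Ensures that the family intersected in \<open>generated\<close> has a member, so that
  generated subalgebras stay inside the carrier.\<close>

lemma subalgebra_power_algebra:
  assumes "is_algebra \<Omega> Q"
  shows "subalgebra \<Omega> (power_algebra \<Omega> Q X) (X \<rightarrow>\<^sub>E carrier Q)"
  unfolding subalgebra_def
proof (intro conjI ballI)
  fix l a assume l: "l \<in> index \<Omega>" and a: "a \<in> arity \<Omega> l \<rightarrow>\<^sub>E (X \<rightarrow>\<^sub>E carrier Q)"
  have "oper Q l (\<lambda>k\<in>arity \<Omega> l. a k x) \<in> carrier Q" if "x \<in> X" for x
  proof -
    have "(\<lambda>k\<in>arity \<Omega> l. a k x) \<in> arity \<Omega> l \<rightarrow>\<^sub>E carrier Q"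
      using a that by (auto simp: PiE_iff)
    then show ?thesis
      using assms l by (simp add: is_algebra_def)
  qed
  then show "oper (power_algebra \<Omega> Q X) l a \<in> X \<rightarrow>\<^sub>E carrier Q"
    by (simp add: oper_power_algebra)
qed simp

lemma subalgebra_generated:
  assumes "is_algebra \<Omega> Q" "S \<subseteq> X \<rightarrow>\<^sub>E carrier Q"
  shows "subalgebra \<Omega> (power_algebra \<Omega> Q X) (generated \<Omega> (power_algebra \<Omega> Q X) S)"
  unfolding subalgebra_def
proof (intro conjI ballI)
  show "generated \<Omega> (power_algebra \<Omega> Q X) S \<subseteq> carrier (power_algebra \<Omega> Q X)"
    using subalgebra_power_algebra[OF assms(1), of X] assms(2) by (auto simp: generated_def)
  fix l a
  assume l: "l \<in> index \<Omega>" and a: "a \<in> arity \<Omega> l \<rightarrow>\<^sub>E generated \<Omega> (power_algebra \<Omega> Q X) S"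
  show "oper (power_algebra \<Omega> Q X) l a \<in> generated \<Omega> (power_algebra \<Omega> Q X) S"
    unfolding generated_def
  proof (rule InterI, clarify)
    fix B assume B: "subalgebra \<Omega> (power_algebra \<Omega> Q X) B" "S \<subseteq> B"
    then have "a \<in> arity \<Omega> l \<rightarrow>\<^sub>E B"
      using a by (auto simp: generated_def PiE_iff)
    with B l show "oper (power_algebra \<Omega> Q X) l a \<in> B"
      by (simp add: subalgebra_def)
  qed
qed

lemma generated_base: "S \<subseteq> generated \<Omega> A S"
  by (auto simp: generated_def)

lemma generated_least: "subalgebra \<Omega> A B \<Longrightarrow> S \<subseteq> B \<Longrightarrow> generated \<Omega> A S \<subseteq> B"
  by (auto simp: generated_def)

section \<open>Spaces and continuous maps\<close>

lemma Obj_Q_TOP: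
  "S \<in> Obj (Q_TOP \<Omega> Q) \<longleftrightarrow>
     small (fst S) \<and> subalgebra \<Omega> (power_algebra \<Omega> Q (fst S)) (snd S)"
  by (auto simp: Q_TOP_def Q_topology_def)

lemma Obj_Q_TOP0:
  "S \<in> Obj (Q_TOP0 \<Omega> Q) \<longleftrightarrow> S \<in> Obj (Q_TOP \<Omega> Q) \<and> Q_T0 S"
  by (auto simp: Q_TOP0_def full_subcategory_def)

lemma category_Q_TOP0 [simp]:
  "Hom (Q_TOP0 \<Omega> Q) = Q_continuous_maps"
  "comp (Q_TOP0 \<Omega> Q) S T U g f = compose (fst S) g f"
  "ident (Q_TOP0 \<Omega> Q) S = (\<lambda>x\<in>fst S. x)"
  by (simp_all add: Q_TOP0_def full_subcategory_def Q_TOP_def)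

lemma topology_PiE:
  "S \<in> Obj (Q_TOP \<Omega> Q) \<Longrightarrow> p \<in> snd S \<Longrightarrow> p \<in> fst S \<rightarrow>\<^sub>E carrier Q"
  by (auto simp: Obj_Q_TOP subalgebra_def)

lemma topology_oper:
  "S \<in> Obj (Q_TOP \<Omega> Q) \<Longrightarrow> l \<in> index \<Omega> \<Longrightarrow> a \<in> arity \<Omega> l \<rightarrow>\<^sub>E snd S \<Longrightarrow>
     oper (power_algebra \<Omega> Q (fst S)) l a \<in> snd S"
  by (auto simp: Obj_Q_TOP subalgebra_def)

lemma continuous_PiE: "f \<in> Q_continuous_maps S T \<Longrightarrow> f \<in> fst S \<rightarrow>\<^sub>E fst T"
  by (simp add: Q_continuous_maps_def)

lemma continuous_in: "f \<in> Q_continuous_maps S T \<Longrightarrow> x \<in> fst S \<Longrightarrow> f x \<in> fst T"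
  by (auto simp: Q_continuous_maps_def)

lemma continuous_compose:
  "f \<in> Q_continuous_maps S T \<Longrightarrow> q \<in> snd T \<Longrightarrow> compose (fst S) q f \<in> snd S"
  by (simp add: Q_continuous_maps_def)

lemma continuous_comp:
  fixes S T U :: "('u, 'q) qspace"
  assumes f: "f \<in> Q_continuous_maps S T" and g: "g \<in> Q_continuous_maps T U"
  shows "compose (fst S) g f \<in> Q_continuous_maps S U"
proof -
  have "compose (fst S) q (compose (fst S) g f) \<in> snd S" if "q \<in> snd U" for q
  proof -
    have "compose (fst S) q (compose (fst S) g f) = compose (fst S) (compose (fst T) q g) f"
      using compose_assoc[of f "fst S" "fst T" q g] continuous_PiE[OF f] by (simp add: PiE_def)
    then show ?thesis
      using continuous_compose[OF f continuous_compose[OF g that]] by simp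
  qed
  moreover have "compose (fst S) g f \<in> fst S \<rightarrow>\<^sub>E fst U"
    using continuous_in[OF f] continuous_in[OF g] by (auto simp: compose_def)
  ultimately show ?thesis
    by (simp add: Q_continuous_maps_def)
qed

lemma continuous_ident:
  assumes "S \<in> Obj (Q_TOP \<Omega> Q)"
  shows "(\<lambda>x\<in>fst S. x) \<in> Q_continuous_maps S S"
proof -
  have "ident (Q_TOP \<Omega> Q) S \<in> Hom (Q_TOP \<Omega> Q) S S"
    using assms is_category_Q_TOP[of \<Omega> Q] unfolding is_category_def by blast
  then show ?thesis
    by (simp add: Q_TOP_def)
qed

section \<open>Points and sobriety\<close>

lemma pt_iff:
  "h \<in> pt \<Omega> Q S \<longleftrightarrow> h \<in> snd S \<rightarrow>\<^sub>E carrier Q \<and>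
     (\<forall>l \<in> index \<Omega>. \<forall>a \<in> arity \<Omega> l \<rightarrow>\<^sub>E snd S.
        h (oper (power_algebra \<Omega> Q (fst S)) l a) = oper Q l (\<lambda>k\<in>arity \<Omega> l. h (a k)))"
  by (simp add: pt_def alg_hom_def restrict_algebra_def)

lemma eta_in_pt:
  assumes "S \<in> Obj (Q_TOP \<Omega> Q)" "x \<in> fst S"
  shows "eta S x \<in> pt \<Omega> Q S"
proof -
  have "eta S x (oper (power_algebra \<Omega> Q (fst S)) l a) = oper Q l (\<lambda>k\<in>arity \<Omega> l. eta S x (a k))"
    if "l \<in> index \<Omega>" "a \<in> arity \<Omega> l \<rightarrow>\<^sub>E snd S" for l a
  proof -
    have "eta S x (oper (power_algebra \<Omega> Q (fst S)) l a) =
        oper (power_algebra \<Omega> Q (fst S)) l a x"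
      using topology_oper[OF assms(1) that] by (simp add: eta_def)
    also have "\<dots> = oper Q l (\<lambda>k\<in>arity \<Omega> l. eta S x (a k))"
      using assms(2) that by (auto simp: oper_power_algebra_apply eta_def PiE_iff cong: restrict_cong)
    finally show ?thesis .
  qed
  moreover have "eta S x \<in> snd S \<rightarrow>\<^sub>E carrier Q"
    using topology_PiE[OF assms(1)] assms(2) by (fastforce simp: eta_def PiE_iff)
  ultimately show ?thesis by (simp add: pt_iff)
qed

text \<open>\<open>eta\<close> always lands in the points. Its injectivity is the separation axiom,
  and its surjectivity is the second conjunct, because points are extensional on
  \<open>snd S\<close>.\<close>

lemma Q_sober_iff:
  assumes "S \<in> Obj (Q_TOP \<Omega> Q)"
  shows "Q_sober \<Omega> Q S \<longleftrightarrow>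
    Q_T0 S \<and> (\<forall>h \<in> pt \<Omega> Q S. \<exists>x \<in> fst S. \<forall>p \<in> snd S. h p = p x)"
proof -
  have "inj_on (eta S) (fst S) \<longleftrightarrow> Q_T0 S"
    by (auto simp: inj_on_def Q_T0_def eta_def fun_eq_iff restrict_def; metis)
  moreover have "h = eta S x \<longleftrightarrow> (\<forall>p \<in> snd S. h p = p x)" if "h \<in> pt \<Omega> Q S" for h x
    using that by (auto simp: pt_iff eta_def fun_eq_iff PiE_iff extensional_def)
  then have "pt \<Omega> Q S \<subseteq> eta S ` fst S \<longleftrightarrow>
      (\<forall>h \<in> pt \<Omega> Q S. \<exists>x \<in> fst S. \<forall>p \<in> snd S. h p = p x)"
    by (auto simp: subset_eq image_iff)
  moreover have "eta S ` fst S \<subseteq> pt \<Omega> Q S"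
    using eta_in_pt[OF assms] by auto
  ultimately show ?thesis by (auto simp: Q_sober_def bij_betw_def)
qed

text \<open>A homomorphism \<open>\<phi>\<close> of topologies carries points backwards by
  composition. It is applied to precomposition with a continuous map, to evaluation on the point
  space, and to the inverse of restriction along a reflection.\<close>

lemma pt_hom_compose:
  assumes S: "S \<in> Obj (Q_TOP \<Omega> Q)" and h: "h \<in> pt \<Omega> Q S"
    and T: "T \<in> Obj (Q_TOP \<Omega> Q)"
    and \<phi>: "\<And>q. q \<in> snd T \<Longrightarrow> \<phi> q \<in> snd S"
    and hom: "\<And>l b. l \<in> index \<Omega> \<Longrightarrow> b \<in> arity \<Omega> l \<rightarrow>\<^sub>E snd T \<Longrightarrow>
      \<phi> (oper (power_algebra \<Omega> Q (fst T)) l b) =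
      oper (power_algebra \<Omega> Q (fst S)) l (\<lambda>k\<in>arity \<Omega> l. \<phi> (b k))"
  shows "(\<lambda>q\<in>snd T. h (\<phi> q)) \<in> pt \<Omega> Q T"
proof -
  have "h (\<phi> (oper (power_algebra \<Omega> Q (fst T)) l b)) =
      oper Q l (\<lambda>k\<in>arity \<Omega> l. (\<lambda>q\<in>snd T. h (\<phi> q)) (b k))"
    if lb: "l \<in> index \<Omega>" "b \<in> arity \<Omega> l \<rightarrow>\<^sub>E snd T" for l b
  proof -
    have "(\<lambda>k\<in>arity \<Omega> l. \<phi> (b k)) \<in> arity \<Omega> l \<rightarrow>\<^sub>E snd S"
      using \<phi> lb by auto
    then have "h (\<phi> (oper (power_algebra \<Omega> Q (fst T)) l b)) =
        oper Q l (\<lambda>k\<in>arity \<Omega> l. h ((\<lambda>k\<in>arity \<Omega> l. \<phi> (b k)) k))"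
      using h lb hom by (simp add: pt_iff)
    also have "\<dots> = oper Q l (\<lambda>k\<in>arity \<Omega> l. (\<lambda>q\<in>snd T. h (\<phi> q)) (b k))"
      using lb by (auto simp: PiE_iff cong: restrict_cong)
    finally show ?thesis .
  qed
  moreover have "(\<lambda>q\<in>snd T. h (\<phi> q)) \<in> snd T \<rightarrow>\<^sub>E carrier Q"
    using h \<phi> by (auto simp: pt_iff)
  ultimately show ?thesis
    using topology_oper[OF T] by (simp add: pt_iff)
qed

text \<open>Functoriality of the space of points: precomposition with \<open>f\<close> is a
  homomorphism from the topology of \<open>T\<close> to that of \<open>S\<close>.\<close>

lemma pt_continuous_image:
  assumes "S \<in> Obj (Q_TOP \<Omega> Q)" "T \<in> Obj (Q_TOP \<Omega> Q)"
    and "f \<in> Q_continuous_maps S T" "h \<in> pt \<Omega> Q S"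
  shows "(\<lambda>q\<in>snd T. h (compose (fst S) q f)) \<in> pt \<Omega> Q T"
  by (rule pt_hom_compose[where \<phi> = "\<lambda>q. compose (fst S) q f", OF assms(1,4,2)])
    (simp_all add: continuous_compose[OF assms(3)] compose_oper_power_algebra[OF continuous_PiE[OF assms(3)]])

text \<open>The topology lies in \<open>Q^X\<close> and the points lie in a power of
  \<open>Q\<close> indexed by the topology; each of the two exponentiations preserves
  smallness.\<close>

lemma small_pt:
  fixes Q :: "('i, 'n, 'u) algebra" and S :: "('u, 'u) qspace"
  assumes "strong_limit TYPE('u)" "small (carrier Q)" "S \<in> Obj (Q_TOP \<Omega> Q)"
  shows "pt \<Omega> Q S \<prec> (UNIV :: 'u set)"
proof -
  have Q: "carrier Q \<prec> (UNIV :: 'u set)" and X: "fst S \<prec> (UNIV :: 'u set)"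
    using assms by (simp_all add: small_def Obj_Q_TOP)
  have "snd S \<lesssim> fst S \<rightarrow>\<^sub>E carrier Q"
    using topology_PiE[OF assms(3)] by (intro subset_imp_lepoll) blast
  then have "snd S \<prec> (UNIV :: 'u set)"
    using PiE_lesspoll_UNIV[OF assms(1) X Q] by (rule lesspoll_trans1)
  moreover have "pt \<Omega> Q S \<lesssim> snd S \<rightarrow>\<^sub>E carrier Q"
    by (intro subset_imp_lepoll) (auto simp: pt_iff)
  ultimately show ?thesis
    using PiE_lesspoll_UNIV[OF assms(1) _ Q] by (blast intro: lesspoll_trans1)
qed


section \<open>The Sierpinski space\<close>

lemma Q_Sierpinski_Obj:
  assumes "is_algebra \<Omega> Q" "small (carrier Q)"
  shows "Q_Sierpinski \<Omega> Q \<in> Obj (Q_TOP \<Omega> Q)"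
  using assms by (simp add: Obj_Q_TOP Q_Sierpinski_def subalgebra_generated)

text \<open>Pulling back the identity gives one direction. For the other, the maps in
  \<open>Q^Q\<close> whose composite with \<open>p\<close> lies in the topology form a subalgebra
  containing the identity, hence contain everything it generates.\<close>

lemma continuous_Q_Sierpinski_iff:
  assumes "is_algebra \<Omega> Q" and S: "S \<in> Obj (Q_TOP \<Omega> Q)"
  shows "p \<in> Q_continuous_maps S (Q_Sierpinski \<Omega> Q) \<longleftrightarrow> p \<in> snd S"
proof
  let ?P = "power_algebra \<Omega> Q (carrier Q)"
  assume p: "p \<in> Q_continuous_maps S (Q_Sierpinski \<Omega> Q)"
  have "(\<lambda>x\<in>carrier Q. x) \<in> snd (Q_Sierpinski \<Omega> Q)"
    using generated_base[of "{\<lambda>x\<in>carrier Q. x}" \<Omega> ?P] by (simp add: Q_Sierpinski_def)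
  with p have "compose (fst S) (\<lambda>x\<in>carrier Q. x) p \<in> snd S"
    by (rule continuous_compose)
  then show "p \<in> snd S"
    using Id_compose[of p "fst S" "carrier Q"] continuous_PiE[OF p]
    by (simp add: PiE_def Q_Sierpinski_def)
next
  let ?P = "power_algebra \<Omega> Q (carrier Q)"
  let ?B = "{q \<in> carrier Q \<rightarrow>\<^sub>E carrier Q. compose (fst S) q p \<in> snd S}"
  assume p: "p \<in> snd S"
  have pE: "p \<in> fst S \<rightarrow>\<^sub>E carrier Q"
    using topology_PiE[OF S p] .
  have "subalgebra \<Omega> ?P ?B"
    unfolding subalgebra_def
  proof (intro conjI ballI)
    fix l a assume l: "l \<in> index \<Omega>" and a: "a \<in> arity \<Omega> l \<rightarrow>\<^sub>E ?B"
    have "oper ?P l a \<in> carrier Q \<rightarrow>\<^sub>E carrier Q"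
      using subalgebra_power_algebra[OF assms(1), of "carrier Q"] l a
      unfolding subalgebra_def by (auto simp: PiE_iff)
    moreover have "(\<lambda>k\<in>arity \<Omega> l. compose (fst S) (a k) p) \<in> arity \<Omega> l \<rightarrow>\<^sub>E snd S"
      using a by auto
    ultimately show "oper ?P l a \<in> ?B"
      using topology_oper[OF S l] by (simp add: compose_oper_power_algebra[OF pE])
  qed auto
  moreover have "compose (fst S) (\<lambda>x\<in>carrier Q. x) p = p"
    using Id_compose[of p "fst S" "carrier Q"] pE by (simp add: PiE_def)
  then have "{\<lambda>x\<in>carrier Q. x} \<subseteq> ?B"
    using p by auto
  ultimately have "generated \<Omega> ?P {\<lambda>x\<in>carrier Q. x} \<subseteq> ?B"
    by (rule generated_least)
  then show "p \<in> Q_continuous_maps S (Q_Sierpinski \<Omega> Q)"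
    using pE by (auto simp: Q_continuous_maps_def Q_Sierpinski_def)
qed

text \<open>The identity separates elements. A point \<open>h\<close> and the evaluation at
  \<open>h ?i\<close> agree on the generator \<open>?i\<close>, and the set where two homomorphisms
  agree is a subalgebra, so they agree everywhere.\<close>

lemma Q_sober_Q_Sierpinski:
  assumes "is_algebra \<Omega> Q" "small (carrier Q)"
  shows "Q_sober \<Omega> Q (Q_Sierpinski \<Omega> Q)"
proof -
  let ?S = "Q_Sierpinski \<Omega> Q" and ?P = "power_algebra \<Omega> Q (carrier Q)"
  let ?i = "\<lambda>x\<in>carrier Q. x"
  have S: "?S \<in> Obj (Q_TOP \<Omega> Q)"
    by (rule Q_Sierpinski_Obj[OF assms])
  have fst: "fst ?S = carrier Q" and snd: "snd ?S = generated \<Omega> ?P {?i}"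
    by (simp_all add: Q_Sierpinski_def)
  have i: "?i \<in> snd ?S"
    using generated_base[of "{?i}" \<Omega> ?P] by (simp add: snd)
  have "Q_T0 ?S"
    unfolding Q_T0_def fst
  proof (intro ballI impI)
    fix x y assume "x \<in> carrier Q" "y \<in> carrier Q" "x \<noteq> y"
    then show "\<exists>p\<in>snd ?S. p x \<noteq> p y"
      by (intro bexI[OF _ i]) simp
  qed
  moreover have "\<exists>x\<in>fst ?S. \<forall>p\<in>snd ?S. h p = p x" if h: "h \<in> pt \<Omega> Q ?S" for h
  proof (rule bexI)
    show hi: "h ?i \<in> fst ?S"
      using h i by (auto simp: pt_iff fst)
    let ?B = "{p \<in> snd ?S. h p = p (h ?i)}"
    have "subalgebra \<Omega> ?P ?B"
      unfolding subalgebra_def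
    proof (intro conjI ballI)
      show "?B \<subseteq> carrier ?P"
        using topology_PiE[OF S] by (auto simp: fst)
      fix l a assume l: "l \<in> index \<Omega>" and a: "a \<in> arity \<Omega> l \<rightarrow>\<^sub>E ?B"
      then have a': "a \<in> arity \<Omega> l \<rightarrow>\<^sub>E snd ?S" by auto
      then have "h (oper ?P l a) = oper Q l (\<lambda>k\<in>arity \<Omega> l. h (a k))"
        using h l by (simp add: pt_iff fst)
      also have "\<dots> = oper Q l (\<lambda>k\<in>arity \<Omega> l. a k (h ?i))"
        using a by (auto simp: PiE_iff cong: restrict_cong)
      also have "\<dots> = oper ?P l a (h ?i)"
        using hi by (simp add: oper_power_algebra_apply fst)
      finally show "oper ?P l a \<in> ?B"
        using topology_oper[OF S l a'] by (simp add: fst)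
    qed
    moreover have "{?i} \<subseteq> ?B"
      using i hi by (simp add: fst)
    ultimately have "snd ?S \<subseteq> ?B"
      unfolding snd by (rule generated_least)
    then show "\<forall>p\<in>snd ?S. h p = p (h ?i)" by blast
  qed
  ultimately show ?thesis
    by (simp add: Q_sober_iff[OF S])
qed

lemma Q_Sierpinski_Obj_Q_TOP0:
  assumes "is_algebra \<Omega> Q" "small (carrier Q)"
  shows "Q_Sierpinski \<Omega> Q \<in> Obj (Q_TOP0 \<Omega> Q)"
  using Q_Sierpinski_Obj[OF assms] Q_sober_Q_Sierpinski[OF assms]
  by (simp add: Obj_Q_TOP0 Q_sober_iff)


section \<open>The reflection\<close>

text \<open>
  The points of \<open>S\<close> are themselves not elements of \<open>'u\<close>, so the space of points is carried by a set
  \<open>P\<close> of names for them, \<open>e\<close> being the bijection from names to points.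
\<close>

definition evaluation :: "'u set \<Rightarrow> ('u \<Rightarrow> ('u \<Rightarrow> 'q) \<Rightarrow> 'q) \<Rightarrow> ('u \<Rightarrow> 'q) \<Rightarrow> 'u \<Rightarrow> 'q" where
  "evaluation P e p = (\<lambda>z\<in>P. e z p)"

definition point_space ::
  "('u, 'q) qspace \<Rightarrow> 'u set \<Rightarrow> ('u \<Rightarrow> ('u \<Rightarrow> 'q) \<Rightarrow> 'q) \<Rightarrow> ('u, 'q) qspace" where
  "point_space S P e = (P, evaluation P e ` snd S)"

text \<open>This is \<open>eta\<close> read through the names; \<open>inv_into\<close> is a genuine
  inverse as soon as \<open>e\<close> is a bijection onto the points.\<close>

definition point_map ::
  "('u, 'q) qspace \<Rightarrow> 'u set \<Rightarrow> ('u \<Rightarrow> ('u \<Rightarrow> 'q) \<Rightarrow> 'q) \<Rightarrow> 'u \<Rightarrow> 'u" where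
  "point_map S P e = (\<lambda>x\<in>fst S. inv_into P e (eta S x))"

text \<open>The choice of names stays abstract here; concrete names come from an injection of the
  points into \<open>'u\<close>.\<close>

locale point_names =
  fixes \<Omega> :: "('i, 'n) signature" and Q :: "('i, 'n, 'u) algebra"
    and S :: "('u, 'u) qspace" and P :: "'u set" and e
  assumes S: "S \<in> Obj (Q_TOP \<Omega> Q)"
    and P: "small P"
    and e: "bij_betw e P (pt \<Omega> Q S)"
begin

abbreviation "\<P> \<equiv> point_space S P e"
abbreviation "\<eta> \<equiv> point_map S P e"
abbreviation "ev \<equiv> evaluation P e"

section \<open>Evaluations and the space of points\<close>

lemma fst_space [simp]: "fst \<P> = P"
  and snd_space: "snd \<P> = ev ` snd S"
  by (simp_all add: point_space_def)

lemma e_in_pt: "z \<in> P \<Longrightarrow> e z \<in> pt \<Omega> Q S"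
  using e by (auto simp: bij_betw_def)

lemma point_map_in: "x \<in> fst S \<Longrightarrow> \<eta> x \<in> P"
  using eta_in_pt[OF S] e by (auto simp: point_map_def bij_betw_def inv_into_into)

lemma e_point_map: "x \<in> fst S \<Longrightarrow> p \<in> snd S \<Longrightarrow> e (\<eta> x) p = p x"
  using eta_in_pt[OF S, of x] e f_inv_into_f[of "eta S x" e P]
  by (simp add: point_map_def bij_betw_def eta_def)

lemma point_map_PiE: "\<eta> \<in> fst S \<rightarrow>\<^sub>E P"
  using point_map_in by (auto simp: point_map_def)

text \<open>The name \<open>\<eta> x\<close> stands for evaluation at \<open>x\<close>. Restriction
  along \<open>\<eta>\<close> thus recovers \<open>p\<close> from \<open>ev p\<close>, which gives
  both the continuity of \<open>\<eta>\<close> and the injectivity of \<open>ev\<close>.\<close>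

lemma compose_evaluation:
  assumes "p \<in> snd S"
  shows "compose (fst S) (ev p) \<eta> = p"
proof (rule PiE_ext)
  show "p \<in> fst S \<rightarrow>\<^sub>E carrier Q"
    using topology_PiE[OF S assms] .
  show eq: "compose (fst S) (ev p) \<eta> x = p x" if "x \<in> fst S" for x
    using that assms by (simp add: compose_def evaluation_def point_map_in e_point_map)
  then show "compose (fst S) (ev p) \<eta> \<in> fst S \<rightarrow>\<^sub>E carrier Q"
    using topology_PiE[OF S assms] by (auto simp: PiE_iff)
qed

text \<open>At a name \<open>z\<close> this is the homomorphism law of the point \<open>e z\<close>.
  Hence \<open>ev\<close> is a homomorphism and its image is a topology.\<close>

lemma evaluation_oper:
  assumes "l \<in> index \<Omega>" "a \<in> arity \<Omega> l \<rightarrow>\<^sub>E snd S"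
  shows "ev (oper (power_algebra \<Omega> Q (fst S)) l a) =
    oper (power_algebra \<Omega> Q P) l (\<lambda>k\<in>arity \<Omega> l. ev (a k))"
proof
  fix z
  show "ev (oper (power_algebra \<Omega> Q (fst S)) l a) z =
      oper (power_algebra \<Omega> Q P) l (\<lambda>k\<in>arity \<Omega> l. ev (a k)) z"
  proof (cases "z \<in> P")
    case True
    then have "ev (oper (power_algebra \<Omega> Q (fst S)) l a) z = oper Q l (\<lambda>k\<in>arity \<Omega> l. e z (a k))"
      using e_in_pt[OF True] assms by (simp add: evaluation_def pt_iff)
    also have "\<dots> = oper (power_algebra \<Omega> Q P) l (\<lambda>k\<in>arity \<Omega> l. ev (a k)) z"
      using True by (simp add: oper_power_algebra_apply evaluation_def cong: restrict_cong)
    finally show ?thesis .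
  next
    case False
    then show ?thesis
      by (simp add: evaluation_def oper_power_algebra)
  qed
qed

lemma space_Obj: "\<P> \<in> Obj (Q_TOP \<Omega> Q)"
proof -
  have "subalgebra \<Omega> (power_algebra \<Omega> Q P) (ev ` snd S)"
    unfolding subalgebra_def
  proof (intro conjI ballI)
    show "ev ` snd S \<subseteq> carrier (power_algebra \<Omega> Q P)"
      using e_in_pt by (fastforce simp: evaluation_def pt_iff)
    fix l b assume l: "l \<in> index \<Omega>" and b: "b \<in> arity \<Omega> l \<rightarrow>\<^sub>E ev ` snd S"
    \<comment> \<open>Chosen preimages of the arguments, all at once since arities may be infinite;
      restriction to the arity makes the family extensional.\<close>
    define a where "a = (\<lambda>k\<in>arity \<Omega> l. inv_into (snd S) ev (b k))"
    have "b k \<in> ev ` snd S" if "k \<in> arity \<Omega> l" for k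
      using b that by auto
    then have a: "a \<in> arity \<Omega> l \<rightarrow>\<^sub>E snd S" and "\<And>k. k \<in> arity \<Omega> l \<Longrightarrow> ev (a k) = b k"
      by (auto simp: a_def inv_into_into f_inv_into_f)
    then have "(\<lambda>k\<in>arity \<Omega> l. ev (a k)) = b"
      using b by (auto simp: fun_eq_iff PiE_iff extensional_def)
    then show "oper (power_algebra \<Omega> Q P) l b \<in> ev ` snd S"
      using evaluation_oper[OF l a] topology_oper[OF S l a] by (metis imageI)
  qed
  then show ?thesis
    using P by (simp add: Obj_Q_TOP snd_space)
qed

text \<open>Different names denote different homomorphisms; these differ at some \<open>p\<close>,
  and then \<open>ev p\<close> separates the names.\<close>

lemma space_T0: "Q_T0 \<P>"
  unfolding Q_T0_def
proof (intro ballI impI)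
  fix z w assume "z \<in> fst \<P>" "w \<in> fst \<P>" "z \<noteq> w"
  then have zw: "z \<in> P" "w \<in> P" and "e z \<noteq> e w"
    using e by (auto simp: bij_betw_def inj_on_def)
  moreover have "e z \<in> snd S \<rightarrow>\<^sub>E carrier Q" "e w \<in> snd S \<rightarrow>\<^sub>E carrier Q"
    using e_in_pt zw by (simp_all add: pt_iff)
  ultimately obtain p where "p \<in> snd S" "e z p \<noteq> e w p"
    by (metis PiE_ext)
  then show "\<exists>q\<in>snd \<P>. q z \<noteq> q w"
    using zw by (auto simp: snd_space evaluation_def)
qed

text \<open>Composing a point \<open>h\<close> of \<open>\<P>\<close> with \<open>ev\<close> gives a
  point of \<open>S\<close>. This point has a name \<open>z\<close>, and \<open>h\<close> is
  evaluation at that \<open>z\<close>.\<close>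

lemma space_sober: "Q_sober \<Omega> Q \<P>"
  unfolding Q_sober_iff[OF space_Obj]
proof (intro conjI ballI)
  fix h assume h: "h \<in> pt \<Omega> Q \<P>"
  have "(\<lambda>p\<in>snd S. h (ev p)) \<in> pt \<Omega> Q S"
    by (rule pt_hom_compose[OF space_Obj h S]) (simp_all add: snd_space evaluation_oper)
  then obtain z where z: "z \<in> P" "e z = (\<lambda>p\<in>snd S. h (ev p))"
    using e unfolding bij_betw_def by (metis imageE)
  then have "h (ev p) = ev p z" if "p \<in> snd S" for p
    using that by (simp add: evaluation_def)
  with z show "\<exists>x\<in>fst \<P>. \<forall>q\<in>snd \<P>. h q = q x"
    by (auto simp: snd_space)
qed (rule space_T0)

section \<open>Universal property of the point map\<close>

lemma point_map_continuous: "\<eta> \<in> Q_continuous_maps S \<P>"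
  using point_map_PiE by (auto simp: Q_continuous_maps_def snd_space compose_evaluation)

text \<open>For \<open>q\<close> open in \<open>T\<close>, the composites of \<open>q\<close> with
  \<open>f\<close> and \<open>g\<close> are evaluations \<open>ev p\<close> and
  \<open>ev p'\<close>. Restricting along \<open>\<eta>\<close> gives \<open>p = p'\<close>, so no
  \<open>q\<close> separates \<open>f z\<close> from \<open>g z\<close>.\<close>

lemma point_map_epi:
  assumes "Q_T0 T" "f \<in> Q_continuous_maps \<P> T" "g \<in> Q_continuous_maps \<P> T"
    and eq: "compose (fst S) f \<eta> = compose (fst S) g \<eta>"
  shows "f = g"
proof (rule PiE_ext)
  show "f \<in> P \<rightarrow>\<^sub>E fst T" "g \<in> P \<rightarrow>\<^sub>E fst T"
    using assms(2,3) by (auto dest!: continuous_PiE)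
  fix z assume z: "z \<in> P"
  have "q (f z) = q (g z)" if q: "q \<in> snd T" for q
  proof -
    obtain p p' where p: "p \<in> snd S" "compose P q f = ev p"
      and p': "p' \<in> snd S" "compose P q g = ev p'"
      using continuous_compose[OF assms(2) q] continuous_compose[OF assms(3) q]
      by (auto simp: snd_space)
    have "p = compose (fst S) (compose P q f) \<eta>"
      using p compose_evaluation by simp
    also have "\<dots> = compose (fst S) q (compose (fst S) f \<eta>)"
      using compose_assoc[of \<eta> "fst S" P q f] point_map_PiE by (simp add: PiE_def)
    also have "\<dots> = compose (fst S) (compose P q g) \<eta>"
      using compose_assoc[of \<eta> "fst S" P q g] point_map_PiE by (simp add: eq PiE_def)
    also have "\<dots> = p'"
      using p' compose_evaluation by simp
    finally have "compose P q f = compose P q g"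
      using p p' by simp
    then show ?thesis
      using z by (metis compose_eq)
  qed
  then show "f z = g z"
    using assms(1) continuous_in[OF assms(2)] continuous_in[OF assms(3)] z
    unfolding Q_T0_def fst_space by metis
qed

text \<open>The map \<open>f\<close> pushes each point \<open>e z\<close> of \<open>S\<close>
  forward to a point of \<open>T\<close>, which by sobriety is evaluation at some element
  \<open>y z\<close>; the extension sends \<open>z\<close> to \<open>y z\<close>.\<close>

lemma point_map_extension:
  assumes T: "T \<in> Obj (Q_TOP \<Omega> Q)" "Q_sober \<Omega> Q T" and f: "f \<in> Q_continuous_maps S T"
  obtains g where "g \<in> Q_continuous_maps \<P> T" "f = compose (fst S) g \<eta>"
proof -
  have "\<exists>y\<in>fst T. \<forall>q\<in>snd T. e z (compose (fst S) q f) = q y" if "z \<in> P" for z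
    using pt_continuous_image[OF S T(1) f e_in_pt[OF that]] T(2)
    unfolding Q_sober_iff[OF T(1)] by fastforce
  then obtain y where y: "\<And>z. z \<in> P \<Longrightarrow> y z \<in> fst T"
    and ey: "\<And>z q. z \<in> P \<Longrightarrow> q \<in> snd T \<Longrightarrow> e z (compose (fst S) q f) = q (y z)"
    by metis
  let ?g = "\<lambda>z\<in>P. y z"
  \<comment> \<open>Continuity of the extension: pulling \<open>q\<close> back along it yields the
    evaluation at the pullback of \<open>q\<close> along \<open>f\<close>.\<close>
  have "compose P q ?g = ev (compose (fst S) q f)" if "q \<in> snd T" for q
    using ey that by (auto simp: compose_def evaluation_def fun_eq_iff)
  then have g: "?g \<in> Q_continuous_maps \<P> T"
    using y continuous_compose[OF f] by (auto simp: Q_continuous_maps_def snd_space)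
  moreover have "f = compose (fst S) ?g \<eta>"
  proof (rule PiE_ext)
    show "f \<in> fst S \<rightarrow>\<^sub>E fst T"
      using continuous_PiE[OF f] .
    show "compose (fst S) ?g \<eta> \<in> fst S \<rightarrow>\<^sub>E fst T"
      using continuous_PiE[OF continuous_comp[OF point_map_continuous g]] .
    fix x assume x: "x \<in> fst S"
    have "q (f x) = q (y (\<eta> x))" if "q \<in> snd T" for q
      using ey[OF point_map_in[OF x] that] e_point_map[OF x continuous_compose[OF f that]] x
      by (simp add: compose_eq)
    then have "f x = y (\<eta> x)"
      using T(2) y[OF point_map_in[OF x]] continuous_in[OF f x]
      unfolding Q_sober_iff[OF T(1)] Q_T0_def by blast
    then show "f x = compose (fst S) ?g \<eta> x"
      using x point_map_in[OF x] by (simp add: compose_eq)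
  qed
  ultimately show ?thesis by (rule that)
qed

end

section \<open>Epireflectivity of the sober spaces\<close>

lemma Q_SOB_T0: "S \<in> Q_SOB \<Omega> Q \<Longrightarrow> S \<in> Obj (Q_TOP0 \<Omega> Q)"
  by (auto simp: Q_SOB_def Obj_Q_TOP0 Q_sober_iff)

lemma epireflective_Q_SOB:
  fixes Q :: "('i, 'n, 'u) algebra"
  assumes "strong_limit TYPE('u)" "small (carrier Q)"
  shows "epireflective (Q_TOP0 \<Omega> Q) (Q_SOB \<Omega> Q :: ('u, 'u) qspace set)"
  unfolding epireflective_def
proof (intro conjI ballI)
  show "Q_SOB \<Omega> Q \<subseteq> Obj (Q_TOP0 \<Omega> Q)"
    using Q_SOB_T0 by blast
  fix S :: "('u, 'u) qspace" assume "S \<in> Obj (Q_TOP0 \<Omega> Q)"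
  then have S: "S \<in> Obj (Q_TOP \<Omega> Q)"
    by (simp add: Obj_Q_TOP0)
  have pt: "pt \<Omega> Q S \<prec> (UNIV :: 'u set)"
    by (rule small_pt[OF assms S])
  \<comment> \<open>Smallness of the set of points supplies names for them in
    \<open>'u\<close>.\<close>
  then obtain i :: "(('u \<Rightarrow> 'u) \<Rightarrow> 'u) \<Rightarrow> 'u" where i: "inj_on i (pt \<Omega> Q S)"
    by (auto simp: lesspoll_def lepoll_def)
  interpret point_names \<Omega> Q S "i ` pt \<Omega> Q S" "inv_into (pt \<Omega> Q S) i"
  proof
    show "small (i ` pt \<Omega> Q S)"
      using pt i by (simp add: small_def)
    show "bij_betw (inv_into (pt \<Omega> Q S) i) (i ` pt \<Omega> Q S) (pt \<Omega> Q S)"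
      using i by (simp add: bij_betw_inv_into inj_on_imp_bij_betw)
  qed (rule S)
  have "epimorphism (Q_TOP0 \<Omega> Q) S \<P> \<eta>"
    using point_map_continuous point_map_epi by (auto simp: epimorphism_def Obj_Q_TOP0)
  moreover have "\<P> \<in> Q_SOB \<Omega> Q"
    using space_Obj space_sober by (simp add: Q_SOB_def)
  moreover have "\<exists>!g. g \<in> Q_continuous_maps \<P> T \<and> f = compose (fst S) g \<eta>"
    if "T \<in> Q_SOB \<Omega> Q" "f \<in> Q_continuous_maps S T" for T f
  proof (rule ex_ex1I)
    show "\<exists>g. g \<in> Q_continuous_maps \<P> T \<and> f = compose (fst S) g \<eta>"
      using that point_map_extension by (metis (mono_tags, lifting) Q_SOB_def mem_Collect_eq)
    show "g = g'" if "g \<in> Q_continuous_maps \<P> T \<and> f = compose (fst S) g \<eta>"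
      "g' \<in> Q_continuous_maps \<P> T \<and> f = compose (fst S) g' \<eta>" for g g'
      using that point_map_epi[of T g g'] Q_SOB_T0[OF \<open>T \<in> Q_SOB \<Omega> Q\<close>]
      by (simp add: Obj_Q_TOP0)
  qed
  ultimately show "\<exists>RX\<in>Q_SOB \<Omega> Q. \<exists>r. epimorphism (Q_TOP0 \<Omega> Q) S RX r \<and>
      (\<forall>Y\<in>Q_SOB \<Omega> Q. \<forall>f\<in>Hom (Q_TOP0 \<Omega> Q) S Y.
        \<exists>!f'. f' \<in> Hom (Q_TOP0 \<Omega> Q) RX Y \<and> f = comp (Q_TOP0 \<Omega> Q) S RX Y f' r)"
    unfolding category_Q_TOP0 by blast
qed


section \<open>Minimality\<close>

text \<open>Here \<open>T\<close> is a retract of \<open>S\<close>. Pushing a point \<open>h\<close>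
  of \<open>T\<close> along \<open>g\<close> gives evaluation at some \<open>x\<close>; every
  \<open>q\<close> equals its pullback along \<open>f\<close> pulled back again along
  \<open>g\<close>, so \<open>h\<close> is evaluation at \<open>f x\<close>.\<close>

lemma Q_sober_retract:
  assumes S: "S \<in> Obj (Q_TOP \<Omega> Q)" "Q_sober \<Omega> Q S"
    and T: "T \<in> Obj (Q_TOP \<Omega> Q)" "Q_T0 T"
    and f: "f \<in> Q_continuous_maps S T" and g: "g \<in> Q_continuous_maps T S"
    and fg: "compose (fst T) f g = (\<lambda>y\<in>fst T. y)"
  shows "Q_sober \<Omega> Q T"
  unfolding Q_sober_iff[OF T(1)]
proof (intro conjI ballI)
  fix h assume h: "h \<in> pt \<Omega> Q T"
  obtain x where x: "x \<in> fst S" "\<And>p. p \<in> snd S \<Longrightarrow> h (compose (fst T) p g) = p x"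
    using pt_continuous_image[OF T(1) S(1) g h] S(2) unfolding Q_sober_iff[OF S(1)] by fastforce
  have "h q = q (f x)" if q: "q \<in> snd T" for q
  proof -
    have "compose (fst T) (compose (fst S) q f) g = compose (fst T) q (\<lambda>y\<in>fst T. y)"
      using compose_assoc[of g "fst T" "fst S" q f] continuous_PiE[OF g] fg by (simp add: PiE_def)
    also have "\<dots> = q"
      using compose_Id[of q "fst T" "carrier Q"] topology_PiE[OF T(1) q] by (simp add: PiE_def)
    finally show ?thesis
      using x(2)[OF continuous_compose[OF f q]] x(1) by (simp add: compose_eq)
  qed
  with continuous_in[OF f x(1)] show "\<exists>y\<in>fst T. \<forall>q\<in>snd T. h q = q y" by blast
qed (rule T(2))

lemma iso_closed_Q_SOB:
  "iso_closed (Q_TOP0 \<Omega> Q) (Q_SOB \<Omega> Q :: ('u, 'q) qspace set)"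
  unfolding iso_closed_def
proof (intro ballI impI)
  fix S T :: "('u, 'q) qspace"
  assume S: "S \<in> Q_SOB \<Omega> Q" and T: "T \<in> Obj (Q_TOP0 \<Omega> Q)"
    and "isomorphic (Q_TOP0 \<Omega> Q) S T"
  then obtain f g where "f \<in> Q_continuous_maps S T" "g \<in> Q_continuous_maps T S"
    and "compose (fst T) f g = (\<lambda>y\<in>fst T. y)"
    by (auto simp: isomorphic_def)
  then show "T \<in> Q_SOB \<Omega> Q"
    using S T Q_sober_retract[of S \<Omega> Q T f g] by (simp add: Q_SOB_def Obj_Q_TOP0)
qed

text \<open>Restriction along \<open>r\<close> maps the topology of \<open>T\<close> onto that of
  \<open>S\<close> by \<open>ext\<close>, and injectively because \<open>r\<close> is epi. Its
  inverse \<open>k\<close> turns elements of \<open>T\<close> into points of \<open>S\<close>, which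
  sobriety realizes by elements of \<open>S\<close>.\<close>

lemma Q_SOB_isomorphic_reflection:
  fixes Q :: "('i, 'n, 'u) algebra" and S T :: "('u, 'u) qspace"
  assumes alg: "is_algebra \<Omega> Q" "small (carrier Q)"
    and S: "S \<in> Q_SOB \<Omega> Q" and T: "T \<in> Obj (Q_TOP0 \<Omega> Q)"
    and epi: "epimorphism (Q_TOP0 \<Omega> Q) S T r"
    and ext: "\<And>p. p \<in> snd S \<Longrightarrow> \<exists>q \<in> snd T. p = compose (fst S) q r"
  shows "isomorphic (Q_TOP0 \<Omega> Q) T S"
proof -
  have S': "S \<in> Obj (Q_TOP \<Omega> Q)" "Q_sober \<Omega> Q S" "Q_T0 S" and T': "T \<in> Obj (Q_TOP \<Omega> Q)"
    using S T Q_SOB_T0[OF S] by (simp_all add: Q_SOB_def Obj_Q_TOP0)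
  have r: "r \<in> Q_continuous_maps S T"
    and r_epi: "\<And>U f g. U \<in> Obj (Q_TOP0 \<Omega> Q) \<Longrightarrow> f \<in> Q_continuous_maps T U \<Longrightarrow>
      g \<in> Q_continuous_maps T U \<Longrightarrow> compose (fst S) f r = compose (fst S) g r \<Longrightarrow> f = g"
    using epi by (auto simp: epimorphism_def)
  obtain k where k: "\<And>p. p \<in> snd S \<Longrightarrow> k p \<in> snd T"
    and kr: "\<And>p. p \<in> snd S \<Longrightarrow> compose (fst S) (k p) r = p"
    using ext by metis
  \<comment> \<open>Members of the topology of \<open>T\<close> are the continuous maps to the
    Sierpinski space, so \<open>r\<close> can be cancelled between them.\<close>
  have k_unique: "k p = q" if "p \<in> snd S" "q \<in> snd T" "compose (fst S) q r = p" for p q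
  proof (rule r_epi[of "Q_Sierpinski \<Omega> Q"])
    show "Q_Sierpinski \<Omega> Q \<in> Obj (Q_TOP0 \<Omega> Q)"
      by (rule Q_Sierpinski_Obj_Q_TOP0[OF alg])
    show "k p \<in> Q_continuous_maps T (Q_Sierpinski \<Omega> Q)" "q \<in> Q_continuous_maps T (Q_Sierpinski \<Omega> Q)"
      using that k by (simp_all add: continuous_Q_Sierpinski_iff[OF alg(1) T'])
    show "compose (fst S) (k p) r = compose (fst S) q r"
      using that kr by simp
  qed
  \<comment> \<open>Both sides restrict to the same function along \<open>r\<close>, so uniqueness
    of preimages makes \<open>k\<close> a homomorphism.\<close>
  have k_oper: "k (oper (power_algebra \<Omega> Q (fst S)) l b) =
      oper (power_algebra \<Omega> Q (fst T)) l (\<lambda>i\<in>arity \<Omega> l. k (b i))"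
    if lb: "l \<in> index \<Omega>" "b \<in> arity \<Omega> l \<rightarrow>\<^sub>E snd S" for l b
  proof (rule k_unique)
    show "oper (power_algebra \<Omega> Q (fst S)) l b \<in> snd S"
      by (rule topology_oper[OF S'(1) lb])
    show "oper (power_algebra \<Omega> Q (fst T)) l (\<lambda>i\<in>arity \<Omega> l. k (b i)) \<in> snd T"
      using lb k by (intro topology_oper[OF T']) auto
    have "(\<lambda>i\<in>arity \<Omega> l. compose (fst S) ((\<lambda>i\<in>arity \<Omega> l. k (b i)) i) r) = b"
      using lb kr by (auto simp: fun_eq_iff PiE_iff extensional_def)
    then show "compose (fst S) (oper (power_algebra \<Omega> Q (fst T)) l (\<lambda>i\<in>arity \<Omega> l. k (b i))) r =
        oper (power_algebra \<Omega> Q (fst S)) l b"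
      by (simp only: compose_oper_power_algebra[OF continuous_PiE[OF r]])
  qed
  have "\<exists>x\<in>fst S. \<forall>p\<in>snd S. k p z = p x" if z: "z \<in> fst T" for z
  proof -
    \<comment> \<open>Evaluation at \<open>z\<close>, transported to the topology of
      \<open>S\<close> through \<open>k\<close>.\<close>
    have "(\<lambda>p\<in>snd S. eta T z (k p)) \<in> pt \<Omega> Q S"
      by (rule pt_hom_compose[OF T' eta_in_pt[OF T' z] S'(1) k k_oper])
    then obtain x where "x \<in> fst S" "\<forall>p\<in>snd S. (\<lambda>p\<in>snd S. eta T z (k p)) p = p x"
      using S'(2) unfolding Q_sober_iff[OF S'(1)] by blast
    then show ?thesis
      using k by (auto simp: eta_def)
  qed
  then obtain y where y: "\<And>z. z \<in> fst T \<Longrightarrow> y z \<in> fst S"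
    and ky: "\<And>z p. z \<in> fst T \<Longrightarrow> p \<in> snd S \<Longrightarrow> k p z = p (y z)"
    by metis
  define g where "g = (\<lambda>z\<in>fst T. y z)"
  have "compose (fst T) p g = k p" if "p \<in> snd S" for p
    using topology_PiE[OF T' k[OF that]] ky that
    by (auto simp: compose_def g_def fun_eq_iff PiE_iff extensional_def)
  then have g: "g \<in> Q_continuous_maps T S"
    using y k by (auto simp: Q_continuous_maps_def g_def)
  have gr: "compose (fst S) g r = (\<lambda>x\<in>fst S. x)"
  proof (rule PiE_ext)
    show "compose (fst S) g r \<in> fst S \<rightarrow>\<^sub>E fst S"
      using continuous_PiE[OF continuous_comp[OF r g]] .
    fix x assume x: "x \<in> fst S"
    have "p (y (r x)) = p x" if "p \<in> snd S" for p
      using ky[OF continuous_in[OF r x] that] kr[OF that] x by (metis compose_eq)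
    then have "y (r x) = x"
      using S'(3) x y[OF continuous_in[OF r x]] unfolding Q_T0_def by blast
    then show "compose (fst S) g r x = (\<lambda>x\<in>fst S. x) x"
      using x continuous_in[OF r x] by (simp add: compose_eq g_def)
  qed auto
  have "compose (fst T) r g = (\<lambda>z\<in>fst T. z)"
  proof (rule r_epi[OF T])
    show "compose (fst T) r g \<in> Q_continuous_maps T T"
      by (rule continuous_comp[OF g r])
    show "(\<lambda>z\<in>fst T. z) \<in> Q_continuous_maps T T"
      by (rule continuous_ident[OF T'])
    have "compose (fst S) (compose (fst T) r g) r = compose (fst S) r (compose (fst S) g r)"
      using compose_assoc[of r "fst S" "fst T" r g] continuous_PiE[OF r] by (simp add: PiE_def)
    also have "\<dots> = compose (fst S) (\<lambda>z\<in>fst T. z) r"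
      using continuous_PiE[OF r] compose_Id[of r "fst S" "fst T"] Id_compose[of r "fst S" "fst T"]
      by (simp add: gr PiE_def)
    finally show "compose (fst S) (compose (fst T) r g) r = compose (fst S) (\<lambda>z\<in>fst T. z) r" .
  qed
  then show ?thesis
    using r g gr by (auto simp: isomorphic_def)
qed

lemma Q_SOB_minimal:
  fixes Q :: "('i, 'n, 'u) algebra" and R :: "('u, 'u) qspace set"
  assumes alg: "is_algebra \<Omega> Q" "small (carrier Q)"
    and R: "epireflective (Q_TOP0 \<Omega> Q) R" "iso_closed (Q_TOP0 \<Omega> Q) R" "Q_Sierpinski \<Omega> Q \<in> R"
  shows "Q_SOB \<Omega> Q \<subseteq> R"
proof
  fix S :: "('u, 'u) qspace" assume S: "S \<in> Q_SOB \<Omega> Q"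
  then have S': "S \<in> Obj (Q_TOP0 \<Omega> Q)" "S \<in> Obj (Q_TOP \<Omega> Q)"
    by (simp_all add: Q_SOB_T0 Q_SOB_def)
  obtain T r where T: "T \<in> R" and r: "epimorphism (Q_TOP0 \<Omega> Q) S T r"
    and ext: "\<And>f. f \<in> Q_continuous_maps S (Q_Sierpinski \<Omega> Q) \<Longrightarrow>
      \<exists>f'. f' \<in> Q_continuous_maps T (Q_Sierpinski \<Omega> Q) \<and> f = compose (fst S) f' r"
    using R(1,3) S'(1) unfolding epireflective_def category_Q_TOP0 by metis
  have T': "T \<in> Obj (Q_TOP0 \<Omega> Q)"
    using R(1) T by (auto simp: epireflective_def)
  then have "\<exists>q\<in>snd T. p = compose (fst S) q r" if "p \<in> snd S" for p
    using ext[of p] that S'(2)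
    by (auto simp: Obj_Q_TOP0 continuous_Q_Sierpinski_iff[OF alg(1)])
  then have "isomorphic (Q_TOP0 \<Omega> Q) T S"
    by (rule Q_SOB_isomorphic_reflection[OF alg S T' r])
  then show "S \<in> R"
    using R(2) T S'(1) by (auto simp: iso_closed_def)
qed

theorem theorem3p3:
  fixes \<Omega> :: "('i, 'n) signature"
    and V :: "('i, 'n, 'u) algebra set"
    and Q :: "('i, 'n, 'u) algebra"
  assumes "strong_limit TYPE('u)"
    and "variety \<Omega> V"
    and "Q \<in> V"
  shows "is_epireflective_hull (Q_TOP0 \<Omega> Q) (Q_Sierpinski \<Omega> Q) (Q_SOB \<Omega> Q)"
proof -
  have alg: "is_algebra \<Omega> Q" "small (carrier Q)"
    using assms(2,3) by (auto simp: variety_def)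
  show ?thesis
    unfolding is_epireflective_hull_def
    using epireflective_Q_SOB[OF assms(1) alg(2)] iso_closed_Q_SOB
      Q_Sierpinski_Obj[OF alg] Q_sober_Q_Sierpinski[OF alg] Q_SOB_minimal[OF alg]
    by (auto simp: Q_SOB_def)
qed

end
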